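(* Let $\mathcal{T}\subseteq\mathcal{A}^{T_M}$ be a tree-shift on a Markov-Cayley tree $T_M$. Then $\mathcal{T}$ is a tree-shift of finite type if and only if $\mathcal{T}$ has the shadowing property.
   Context: **Trees.** Let $\Sigma=\{g_1,\dots,g_d\}$ be a finite set and $M$ a $d\times d$ matrix with entries in $\{0,1\}$ indexed by $\Sigma$. The Markov-Cayley tree $T_M$ is the set of finite words over $\Sigma$ consisting of the empty word $\epsilon$, all letters of $\Sigma$, and all words $g_{i_1}\cdots g_{i_n}$ ($n\ge2$) with $M(g_{i_j},g_{i_{j+1}})=1$ for all $1\le j\le n-1$. $T_M$ is assumed infinite. For a word $g$, $|g-\epsilon|$ is its length. The follower set of $g\in T_M$ is $F_{T_M}(g)=\{h\in T_M: gh\in T_M\}$ (concatenation). Let $\mathcal{I}=\{F_{T_M}(g):g\in T_M\}$ (a finite set). For $\eta\in\mathcal{I}$ put $T_M^{(\eta)}=\{g\in T_M:F_{T_M}(g)=\eta\}$ and $\Delta_m^{(\eta)}=\{g\in\eta:0\le|g-\epsilon|\le m\}$. **Tree-shifts.** Let $\mathcal{A}$ be a finite alphabet. For $t\in\mathcal{A}^{T_M}$ and $g\in T_M^{(\eta)}$, $\sigma_g(t)\in\mathcal{A}^{\eta}$ is given by $(\sigma_g(t))_{g'}=t_{gg'}$ for $g'\in\eta$. More generally, for $s\in\mathcal{A}^{\eta}$ and $g\in\eta$, $\sigma_g(s)$ is defined by $(\sigma_g(s))_{g'}=s_{gg'}$ for all $g'$ with $gg'\in\eta$. A tree-shift $\mathcal{T}$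 on $T_M$ is a set of the form $$\{t\in\mathcal{A}^{T_M}:\sigma_g(t)|_{\Delta_m^{(\eta)}}\notin\mathcal{F}\ \ \forall\eta\in\mathcal{I},\ \forall g\in T_M^{(\eta)},\ \forall m\ge0\}$$ for some $\mathcal{F}\subseteq\bigcup_{m\ge0}\bigcup_{\eta\in\mathcal{I}}\mathcal{A}^{\Delta_m^{(\eta)}}$; it is a tree-shift of finite type (TSFT) if $\mathcal{F}$ can be taken finite. The projected tree-shift is $\mathcal{T}^{\mathcal{I}}=\bigsqcup_{\eta\in\mathcal{I}}\mathcal{T}^{(\eta)}$, with $\mathcal{T}^{(\eta)}=\bigcup_{g\in T_M^{(\eta)}}\{\sigma_g(t):t\in\mathcal{T}\}\subseteq\mathcal{A}^{\eta}$. **Distance.** For $s,t\in\mathcal{A}^{\eta}$, $d(s,t)=\inf\{2^{-m}: m\ge0 \text{ an integer},\ s|_{\Delta_m^{(\eta)}}=t|_{\Delta_m^{(\eta)}}\}$. Convention: $d(s,t)=2$ if $s$ and $t$ differ at $\epsilon$. **Shadowing.** A projected orbit of $\mathcal{T}$ is a function $\mathcal{O}:T_M\to\mathcal{T}^{\mathcal{I}}$ with $\mathcal{O}(g)\in\mathcal{T}^{(\eta)}$ for all $g\in T_M^{(\eta)}$ and all $\eta\in\mathcal{I}$. For $\delta>0$, a projected orbit $\mathcal{O}$ is a $\delta$-projected pseudo orbit if $d(\sigma_{g_i}(\mathcal{O}(g)),\mathcal{O}(gg_i))<\delta$ for all $g\in T_M$ and $g_i\in\Sigma$ with $gg_i\in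 T_M$. For $\varepsilon>0$, such an $\mathcal{O}$ is $\varepsilon$-shadowed by $t\in\mathcal{T}$ if $d(\sigma_g(t),\mathcal{O}(g))<\varepsilon$ for all $g\in T_M$. $\mathcal{T}$ has the shadowing property if for all $\varepsilon>0$ there is $\delta>0$ such that every $\delta$-projected pseudo orbit of $\mathcal{T}$ is $\varepsilon$-shadowed by some point $t\in\mathcal{T}$. *)

theory Defs
  imports Complex_Main "HOL-Library.FuncSet"
begin

definition markov_cayley_tree :: "'g set \<Rightarrow> ('g \<Rightarrow> 'g \<Rightarrow> nat) \<Rightarrow> 'g list set" where
  "markov_cayley_tree S M = {w \<in> lists S. successively (\<lambda>a b. M a b = 1) w}"

text \<open>The remaining notions depend on the tree only through its set \<open>T\<close> of words.\<close>

definition follower_set :: "'g list set \<Rightarrow> 'g list \<Rightarrow> 'g list set" where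
  "follower_set T g = {h \<in> T. g @ h \<in> T}"

definition follower_sets :: "'g list set \<Rightarrow> 'g list set set" where
  "follower_sets T = follower_set T ` T"

definition vertices_of_type :: "'g list set \<Rightarrow> 'g list set \<Rightarrow> 'g list set" where
  "vertices_of_type T \<eta> = {g \<in> T. follower_set T g = \<eta>}"

definition initial_part :: "'g list set \<Rightarrow> nat \<Rightarrow> 'g list set" where
  "initial_part \<eta> m = {g \<in> \<eta>. length g \<le> m}"

text \<open>
  An element of \<open>A\<^sup>D\<close>, for a set of words \<open>D\<close>, is a partial map with domain exactly \<open>D\<close> and values
  in \<open>A\<close>. A labeling thus carries its domain: labelings of different sets are different, and
  patterns in \<open>A\<^sup>D\<close> and \<open>A\<^sup>E\<close> are identified only if \<open>D = E\<close>.
\<close>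

definition labelings :: "'a set \<Rightarrow> 'g list set \<Rightarrow> ('g list \<rightharpoonup> 'a) set" where
  "labelings A D = {s. dom s = D \<and> ran s \<subseteq> A}"

definition shift_by :: "'g list \<Rightarrow> ('g list \<rightharpoonup> 'a) \<Rightarrow> ('g list \<rightharpoonup> 'a)" where
  "shift_by g s = (\<lambda>h. s (g @ h))"

text \<open>
  On a Markov-Cayley tree the domain of \<open>shift_by g t\<close> is the follower set of \<open>g\<close>, because the tree
  is closed under suffixes.
\<close>

lemma shift_by_in_labelings:
  assumes "T = markov_cayley_tree S M" and "t \<in> labelings A T"
  shows "shift_by g t \<in> labelings A (follower_set T g)"
proof -
  have "h \<in> T" if "g @ h \<in> T" for h
    using that unfolding assms(1) markov_cayley_tree_def
    by (auto simp: successively_append_iff)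
  then show ?thesis
    using assms(2) by (auto simp: labelings_def shift_by_def follower_set_def dom_def ran_def)
qed

definition tree_patterns :: "'g list set \<Rightarrow> 'a set \<Rightarrow> ('g list \<rightharpoonup> 'a) set" where
  "tree_patterns T A = (\<Union>m. \<Union>\<eta>\<in>follower_sets T. labelings A (initial_part \<eta> m))"

definition avoiding :: "'g list set \<Rightarrow> 'a set \<Rightarrow> ('g list \<rightharpoonup> 'a) set \<Rightarrow> ('g list \<rightharpoonup> 'a) set" where
  "avoiding T A F = {t \<in> labelings A T.
     \<forall>\<eta>\<in>follower_sets T. \<forall>g\<in>vertices_of_type T \<eta>. \<forall>m. shift_by g t |` initial_part \<eta> m \<notin> F}"

definition tree_shift :: "'g list set \<Rightarrow> 'a set \<Rightarrow> ('g list \<rightharpoonup> 'a) set \<Rightarrow> bool" where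
  "tree_shift T A X \<longleftrightarrow> (\<exists>F \<subseteq> tree_patterns T A. X = avoiding T A F)"

definition tree_shift_of_finite_type :: "'g list set \<Rightarrow> 'a set \<Rightarrow> ('g list \<rightharpoonup> 'a) set \<Rightarrow> bool" where
  "tree_shift_of_finite_type T A X \<longleftrightarrow>
     (\<exists>F \<subseteq> tree_patterns T A. finite F \<and> X = avoiding T A F)"

definition projection :: "'g list set \<Rightarrow> ('g list \<rightharpoonup> 'a) set \<Rightarrow> 'g list set \<Rightarrow> ('g list \<rightharpoonup> 'a) set" where
  "projection T X \<eta> = (\<Union>g\<in>vertices_of_type T \<eta>. shift_by g ` X)"

text \<open>The union is disjoint because the elements of \<open>projection T X \<eta>\<close> have domain \<open>\<eta>\<close>.\<close>

definition projected_tree_shift :: "'g list set \<Rightarrow> ('g list \<rightharpoonup> 'a) set \<Rightarrow> ('g list \<rightharpoonup> 'a) set" where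
  "projected_tree_shift T X = (\<Union>\<eta>\<in>follower_sets T. projection T X \<eta>)"

text \<open>
  If \<open>s\<close> and \<open>t\<close> differ at the empty word, no \<open>m\<close> qualifies for the infimum and the distance is
  \<open>2\<close> by convention.
\<close>

definition label_dist :: "'g list set \<Rightarrow> ('g list \<rightharpoonup> 'a) \<Rightarrow> ('g list \<rightharpoonup> 'a) \<Rightarrow> real" where
  "label_dist \<eta> s t =
     (if s [] \<noteq> t [] then 2
      else Inf {1 / 2 ^ m | m :: nat. s |` initial_part \<eta> m = t |` initial_part \<eta> m})"

text \<open>The values of an orbit outside \<open>T\<close> are irrelevant.\<close>

definition projected_orbit ::
    "'g list set \<Rightarrow> ('g list \<rightharpoonup> 'a) set \<Rightarrow> ('g list \<Rightarrow> ('g list \<rightharpoonup> 'a)) \<Rightarrow> bool" where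
  "projected_orbit T X Orb \<longleftrightarrow>
     Orb \<in> T \<rightarrow> projected_tree_shift T X \<and>
     (\<forall>\<eta>\<in>follower_sets T. \<forall>g\<in>vertices_of_type T \<eta>. Orb g \<in> projection T X \<eta>)"

text \<open>A letter \<open>a\<close> with \<open>g @ [a] \<in> T\<close> automatically belongs to the generating set of the tree.\<close>

definition projected_pseudo_orbit ::
    "'g list set \<Rightarrow> ('g list \<rightharpoonup> 'a) set \<Rightarrow> real \<Rightarrow> ('g list \<Rightarrow> ('g list \<rightharpoonup> 'a)) \<Rightarrow> bool" where
  "projected_pseudo_orbit T X \<delta> Orb \<longleftrightarrow>
     projected_orbit T X Orb \<and>
     (\<forall>g\<in>T. \<forall>a. g @ [a] \<in> T \<longrightarrow>
        label_dist (follower_set T (g @ [a])) (shift_by [a] (Orb g)) (Orb (g @ [a])) < \<delta>)"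

definition shadowed_by ::
    "'g list set \<Rightarrow> real \<Rightarrow> ('g list \<Rightarrow> ('g list \<rightharpoonup> 'a)) \<Rightarrow> ('g list \<rightharpoonup> 'a) \<Rightarrow> bool" where
  "shadowed_by T \<epsilon> Orb t \<longleftrightarrow>
     (\<forall>g\<in>T. label_dist (follower_set T g) (shift_by g t) (Orb g) < \<epsilon>)"

definition shadowing_property :: "'g list set \<Rightarrow> ('g list \<rightharpoonup> 'a) set \<Rightarrow> bool" where
  "shadowing_property T X \<longleftrightarrow>
     (\<forall>\<epsilon>>0. \<exists>\<delta>>0. \<forall>Orb. projected_pseudo_orbit T X \<delta> Orb \<longrightarrow> (\<exists>t\<in>X. shadowed_by T \<epsilon> Orb t))"

end

theory Submission
  imports Defs
begin

text \<open>
  If \<open>X\<close> is of finite type, then the labels at the roots of a sufficiently fine pseudo orbit form a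
  labeling \<open>t\<close> of the tree, every \<open>O(g)\<close> agrees with \<open>\<sigma>\<^sub>g(t)\<close> up to the height of the forbidden
  patterns, and so \<open>t\<close> lies in \<open>X\<close> and shadows the pseudo orbit. Conversely, let pseudo orbits with
  \<open>\<delta> > 2\<^bsup>-n\<^esup>\<close> be shadowed with \<open>\<epsilon> = 1\<close>. Forbid all patterns of height \<open>n + 2\<close> that do not occur in
  the projected tree-shift. A labeling \<open>t\<close> that avoids them is locally approximated by a pseudo
  orbit, and a point of \<open>X\<close> that shadows this pseudo orbit must be \<open>t\<close> itself. The patterns of
  the trivial type \<open>{\<epsilon>}\<close> cannot be forbidden separately, since \<open>\<Delta>\<^sub>0\<close> is \<open>{\<epsilon>}\<close> for all types; a leaf
  is controlled through its parent instead, which costs one level of height.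
\<close>

section \<open>The distance as agreement up to a level\<close>

lemma restrict_map_eq_iff: "s |` D = t |` D \<longleftrightarrow> (\<forall>h\<in>D. s h = t h)"
  by (auto simp: fun_eq_iff restrict_map_def)

text \<open>An infimum below \<open>1 / 2 ^ n\<close> has a witness \<open>1 / 2 ^ m\<close> below
  it. Its exponent is an integer, so \<open>m \<ge> n + 1\<close>: the strict inequality gains one
  level.\<close>

lemma eq_on_if_label_dist_less:
  assumes "label_dist \<eta> s t < 1 / 2 ^ n" and "h \<in> \<eta>" and "length h \<le> Suc n"
  shows "s h = t h"
proof -
  let ?D = "{1 / 2 ^ m | m :: nat. s |` initial_part \<eta> m = t |` initial_part \<eta> m} :: real set"
  \<comment> \<open>This excludes the conventional value 2, so the infimum branch applies.\<close>
  have "\<not> 2 < (1 :: real) / 2 ^ n"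
    using one_le_power[of "2 :: real" n] by (simp add: field_simps del: one_le_power)
  then have root: "s [] = t []" and less: "Inf ?D < 1 / 2 ^ n"
    using assms(1) by (auto simp: label_dist_def split: if_splits)
  have "s |` initial_part \<eta> 0 = t |` initial_part \<eta> 0"
    using root by (auto simp: restrict_map_eq_iff initial_part_def)
  then have "?D \<noteq> {}"
    by blast
  then obtain m :: nat where m: "1 / 2 ^ m < (1 / 2 ^ n :: real)"
      "s |` initial_part \<eta> m = t |` initial_part \<eta> m"
    using cInf_lessD[OF _ less] by blast
  have "n < m"
    using m(1) by (simp add: field_simps)
  with m(2) assms(2,3) show ?thesis
    by (auto simp: restrict_map_eq_iff initial_part_def)
qed

lemma label_dist_le:
  assumes "[] \<in> \<eta>" and "\<And>h. h \<in> \<eta> \<Longrightarrow> length h \<le> n \<Longrightarrow> s h = t h"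
  shows "label_dist \<eta> s t \<le> 1 / 2 ^ n"
proof -
  let ?D = "{1 / 2 ^ m | m :: nat. s |` initial_part \<eta> m = t |` initial_part \<eta> m} :: real set"
  have "1 / 2 ^ n \<in> ?D"
    using assms(2) by (auto simp: restrict_map_eq_iff initial_part_def)
  moreover have "bdd_below ?D"
    by (rule bdd_belowI[of _ 0]) auto
  ultimately have "Inf ?D \<le> 1 / 2 ^ n"
    by (rule cInf_lower)
  then show ?thesis
    using assms by (simp add: label_dist_def)
qed

lemma exists_inverse_power_less:
  fixes \<epsilon> :: real
  assumes "\<epsilon> > 0"
  obtains n :: nat where "1 / 2 ^ n < \<epsilon>"
proof -
  obtain n :: nat where "(1 / 2) ^ n < \<epsilon>"
    using real_arch_pow_inv[OF assms, of "1 / 2"] by auto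
  then show ?thesis
    using that by (simp add: power_one_over)
qed

lemma finite_labelings:
  assumes "finite A" and "finite D"
  shows "finite (labelings A D)"
  unfolding labelings_def using finite_set_of_finite_maps[OF assms(2,1)] .

lemma restrict_in_labelings:
  assumes "s \<in> labelings A D" and "E \<subseteq> D"
  shows "s |` E \<in> labelings A E"
  using assms by (fastforce simp: labelings_def ran_def restrict_map_def split: if_splits)

section \<open>Follower sets in a Markov-Cayley tree\<close>

lemma Nil_in_tree [simp]: "[] \<in> markov_cayley_tree S M"
  by (simp add: markov_cayley_tree_def)

lemma tree_appendD:
  assumes "g @ h \<in> markov_cayley_tree S M"
  shows "g \<in> markov_cayley_tree S M" and "h \<in> markov_cayley_tree S M"
  using assms by (auto simp: markov_cayley_tree_def successively_append_iff)

lemma Nil_in_follower_set: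
  "g \<in> markov_cayley_tree S M \<Longrightarrow> [] \<in> follower_set (markov_cayley_tree S M) g"
  by (simp add: follower_set_def)

lemma in_follower_set_iff:
  "h \<in> follower_set (markov_cayley_tree S M) g \<longleftrightarrow> g @ h \<in> markov_cayley_tree S M"
  using tree_appendD by (auto simp: follower_set_def)

lemma follower_set_append:
  "h \<in> follower_set (markov_cayley_tree S M) (g @ k) \<longleftrightarrow>
    k @ h \<in> follower_set (markov_cayley_tree S M) g"
  by (simp add: in_follower_set_iff)

text \<open>The matrix constrains adjacent letters only, so once the letter \<open>b\<close> may
  follow \<open>g\<close>, the rest of the word no longer sees \<open>g\<close>.\<close>

lemma follower_set_Cons_iff:
  "b # h \<in> follower_set (markov_cayley_tree S M) g \<longleftrightarrow>
    b # h \<in> markov_cayley_tree S M \<and> [b] \<in> follower_set (markov_cayley_tree S M) g"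
  unfolding in_follower_set_iff
  by (auto simp: markov_cayley_tree_def successively_append_iff)

lemma follower_set_eqI:
  assumes "g \<in> markov_cayley_tree S M" and "k \<in> markov_cayley_tree S M"
    and "\<And>b. [b] \<in> follower_set (markov_cayley_tree S M) g \<longleftrightarrow>
      [b] \<in> follower_set (markov_cayley_tree S M) k"
  shows "follower_set (markov_cayley_tree S M) g = follower_set (markov_cayley_tree S M) k"
proof (rule set_eqI)
  fix h
  show "h \<in> follower_set (markov_cayley_tree S M) g \<longleftrightarrow>
      h \<in> follower_set (markov_cayley_tree S M) k"
  proof (cases h)
    case Nil
    with assms(1,2) show ?thesis by (simp add: Nil_in_follower_set)
  next
    case (Cons b h')
    with assms(3) show ?thesis using follower_set_Cons_iff by metis
  qed
qed

text \<open>A follower set is determined by the letters in it, so follower sets inject into the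
  subsets of \<open>S\<close>.\<close>

lemma finite_follower_sets:
  assumes "finite S"
  shows "finite (follower_sets (markov_cayley_tree S M))"
proof (rule inj_on_finite)
  show "inj_on (\<lambda>\<eta>. {b. [b] \<in> \<eta>}) (follower_sets (markov_cayley_tree S M))"
  proof (rule inj_onI)
    fix \<eta> \<theta>
    assume "\<eta> \<in> follower_sets (markov_cayley_tree S M)"
      and "\<theta> \<in> follower_sets (markov_cayley_tree S M)" and eq: "{b. [b] \<in> \<eta>} = {b. [b] \<in> \<theta>}"
    then obtain g k where "g \<in> markov_cayley_tree S M" "k \<in> markov_cayley_tree S M"
      and "\<eta> = follower_set (markov_cayley_tree S M) g"
      and "\<theta> = follower_set (markov_cayley_tree S M) k"
      by (auto simp: follower_sets_def)
    with eq show "\<eta> = \<theta>"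
      using follower_set_eqI[of g S M k] by blast
  qed
  show "(\<lambda>\<eta>. {b. [b] \<in> \<eta>}) ` follower_sets (markov_cayley_tree S M) \<subseteq> Pow S"
    by (auto simp: follower_sets_def follower_set_def markov_cayley_tree_def)
qed (use assms in simp)

lemma finite_initial_part:
  assumes "finite S" and "\<eta> \<in> follower_sets (markov_cayley_tree S M)"
  shows "finite (initial_part \<eta> m)"
proof (rule finite_subset)
  show "initial_part \<eta> m \<subseteq> {w. set w \<subseteq> S \<and> length w \<le> m}"
    using assms(2)
    by (auto simp: initial_part_def follower_sets_def follower_set_def markov_cayley_tree_def)
qed (rule finite_lists_length_le[OF assms(1)])

text \<open>Fails for \<open>\<eta> = {[]}\<close>: then \<open>initial_part \<theta> 0 = initial_part \<eta> n\<close> for all \<open>\<theta>\<close>.\<close>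

lemma follower_sets_eq_if_initial_part_eq:
  assumes "\<eta> \<in> follower_sets (markov_cayley_tree S M)"
    and "\<theta> \<in> follower_sets (markov_cayley_tree S M)"
    and "\<eta> \<noteq> {[]}" and "n > 0" and "initial_part \<theta> m = initial_part \<eta> n"
  shows "\<theta> = \<eta>"
proof -
  obtain g k where g: "g \<in> markov_cayley_tree S M" "\<eta> = follower_set (markov_cayley_tree S M) g"
    and k: "k \<in> markov_cayley_tree S M" "\<theta> = follower_set (markov_cayley_tree S M) k"
    using assms(1,2) by (auto simp: follower_sets_def)
  obtain h where "h \<in> \<eta>" "h \<noteq> []"
    using assms(3) Nil_in_follower_set[OF g(1)] g(2) by blast
  then obtain b where "[b] \<in> \<eta>"
    using g(2) follower_set_Cons_iff by (metis neq_Nil_conv)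
  then have "[b] \<in> initial_part \<theta> m"
    using assms(4,5) by (simp add: initial_part_def)
  then have "m > 0"
    by (simp add: initial_part_def)
  \<comment> \<open>Both heights are at least 1, so the common initial part shows all letters of
    both follower sets.\<close>
  have "[c] \<in> \<theta> \<longleftrightarrow> [c] \<in> \<eta>" for c
  proof -
    have "[c] \<in> \<theta> \<longleftrightarrow> [c] \<in> initial_part \<theta> m"
      using \<open>m > 0\<close> by (simp add: initial_part_def)
    also have "\<dots> \<longleftrightarrow> [c] \<in> \<eta>"
      unfolding assms(5) using assms(4) by (simp add: initial_part_def)
    finally show ?thesis .
  qed
  then show ?thesis
    unfolding g(2) k(2) by (rule follower_set_eqI[OF k(1) g(1)])
qed

section \<open>Projections and pseudo orbits\<close>

lemma projection_iff:
  "s \<in> projection T X (follower_set T g) \<longleftrightarrow>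
    (\<exists>k\<in>T. \<exists>t\<in>X. follower_set T k = follower_set T g \<and> s = shift_by k t)"
  by (auto simp: projection_def vertices_of_type_def)

text \<open>Each vertex has exactly one type, its own follower set, so a quantifier over types and
  their vertices becomes one over vertices.\<close>

lemma projected_orbit_iff:
  "projected_orbit T X Orb \<longleftrightarrow> (\<forall>g\<in>T. Orb g \<in> projection T X (follower_set T g))"
  by (auto simp: projected_orbit_def projected_tree_shift_def follower_sets_def vertices_of_type_def)

lemma avoiding_iff:
  "t \<in> avoiding T A F \<longleftrightarrow> t \<in> labelings A T \<and>
    (\<forall>g\<in>T. \<forall>m. shift_by g t |` initial_part (follower_set T g) m \<notin> F)"
  by (auto simp: avoiding_def follower_sets_def vertices_of_type_def)

lemma tree_labeling_apply:
  assumes "t \<in> labelings A T" and "g \<in> T"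
  shows "\<exists>a\<in>A. t g = Some a"
  using assms by (auto simp: labelings_def ran_def dom_def)

text \<open>The type of a child depends only on the type of its parent and the letter added. This
  transfers approximations from a parent to a leaf.\<close>

lemma projection_child:
  assumes "s \<in> projection (markov_cayley_tree S M) X (follower_set (markov_cayley_tree S M) g)"
    and "g @ [a] \<in> markov_cayley_tree S M"
  shows "shift_by [a] s \<in>
    projection (markov_cayley_tree S M) X (follower_set (markov_cayley_tree S M) (g @ [a]))"
proof -
  let ?T = "markov_cayley_tree S M"
  obtain k t where k: "t \<in> X" "follower_set ?T k = follower_set ?T g" "s = shift_by k t"
    using assms(1) by (auto simp: projection_iff)
  have "k @ [a] \<in> ?T"
    using assms(2) k(2) in_follower_set_iff by blast
  moreover have "follower_set ?T (k @ [a]) = follower_set ?T (g @ [a])"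
    using k(2) by (auto simp: set_eq_iff follower_set_append)
  moreover have "shift_by [a] s = shift_by (k @ [a]) t"
    by (simp add: k(3) shift_by_def)
  ultimately show ?thesis
    using k(1) unfolding projection_iff by blast
qed

text \<open>The letters of \<open>h\<close> move one by one from the argument of
  \<open>Orb g\<close> to the vertex. Each move is an exact equality because the remaining word
  stays within the level of agreement, so errors do not accumulate.\<close>

lemma pseudo_orbit_apply:
  assumes "projected_pseudo_orbit (markov_cayley_tree S M) X (1 / 2 ^ n) Orb"
    and "g @ h \<in> markov_cayley_tree S M" and "length h \<le> n"
  shows "Orb g h = Orb (g @ h) []"
  using assms(2,3)
proof (induction h arbitrary: g)
  case (Cons a h)
  let ?T = "markov_cayley_tree S M"
  have "(g @ [a]) @ h \<in> ?T"
    using Cons.prems(1) by simp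
  note tree = this tree_appendD(1)[OF this]
  have "label_dist (follower_set ?T (g @ [a])) (shift_by [a] (Orb g)) (Orb (g @ [a])) < 1 / 2 ^ n"
    using assms(1) tree(2) tree_appendD(1)[OF tree(2)] by (simp add: projected_pseudo_orbit_def)
  then have "shift_by [a] (Orb g) h = Orb (g @ [a]) h"
    by (rule eq_on_if_label_dist_less) (use Cons.prems tree in \<open>simp_all add: in_follower_set_iff\<close>)
  with Cons.IH[OF tree(1)] Cons.prems(2) show ?case
    by (simp add: shift_by_def)
qed simp

section \<open>Finite type implies shadowing\<close>

lemma finite_pattern_height:
  assumes "finite F" and "F \<subseteq> tree_patterns T A"
  obtains N where "\<And>p h. p \<in> F \<Longrightarrow> h \<in> dom p \<Longrightarrow> length h \<le> N"
proof -
  \<comment> \<open>Height is read off the domain: the index \<open>m\<close> of a pattern is not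
    unique when the follower set is finite.\<close>
  have "\<exists>m. \<forall>h\<in>dom p. length h \<le> m" if "p \<in> F" for p
    using that assms(2) by (fastforce simp: tree_patterns_def labelings_def initial_part_def)
  then obtain m where "\<And>p h. p \<in> F \<Longrightarrow> h \<in> dom p \<Longrightarrow> length h \<le> m p"
    by metis
  then have "length h \<le> Max (m ` F)" if "p \<in> F" "h \<in> dom p" for p h
    using that assms(1) by (meson Max_ge finite_imageI image_eqI le_trans)
  then show ?thesis
    using that by blast
qed

lemma finite_type_imp_shadowing:
  assumes "tree_shift_of_finite_type (markov_cayley_tree S M) A X"
  shows "shadowing_property (markov_cayley_tree S M) X"
  unfolding shadowing_property_def
proof (intro allI impI)
  fix \<epsilon> :: real
  assume "\<epsilon> > 0"
  let ?T = "markov_cayley_tree S M"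
  obtain F where F: "F \<subseteq> tree_patterns ?T A" "finite F" "X = avoiding ?T A F"
    using assms by (auto simp: tree_shift_of_finite_type_def)
  obtain N where N: "\<And>p h. p \<in> F \<Longrightarrow> h \<in> dom p \<Longrightarrow> length h \<le> N"
    using finite_pattern_height[OF F(2,1)] by blast
  obtain l :: nat where l: "1 / 2 ^ l < \<epsilon>"
    using exists_inverse_power_less[OF \<open>\<epsilon> > 0\<close>] .
  \<comment> \<open>\<open>N\<close> makes the agreement cover every forbidden pattern,
    \<open>l\<close> makes it finer than \<open>\<epsilon>\<close>.\<close>
  define n where "n = max N l"
  have "1 / 2 ^ n \<le> (1 / 2 ^ l :: real)"
    by (simp add: n_def field_simps)
  with l have n: "1 / 2 ^ n < \<epsilon>"
    by linarith
  have "\<exists>t\<in>X. shadowed_by ?T \<epsilon> Orb t" if Orb: "projected_pseudo_orbit ?T X (1 / 2 ^ n) Orb" for Orb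
  proof -
    \<comment> \<open>\<open>Orb\<close> is arbitrary outside the tree; \<open>None\<close> there
      gives \<open>t\<close> the domain required of a labeling.\<close>
    define t where "t = (\<lambda>g. if g \<in> ?T then Orb g [] else None)"
    have t: "shift_by g t h = Orb g h" if "h \<in> follower_set ?T g" "length h \<le> n" for g h
      using that pseudo_orbit_apply[OF Orb, of g h] by (simp add: in_follower_set_iff t_def shift_by_def)
    have proj: "\<exists>k\<in>?T. \<exists>x\<in>X. follower_set ?T k = follower_set ?T g \<and> Orb g = shift_by k x"
      if "g \<in> ?T" for g
      using that Orb unfolding projected_pseudo_orbit_def projected_orbit_iff projection_iff by blast
    have "t \<in> labelings A ?T"
    proof -
      have "\<exists>a\<in>A. t g = Some a" if g: "g \<in> ?T" for g
      proof -
        obtain k x where "k \<in> ?T" "x \<in> X" "Orb g = shift_by k x"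
          using proj[OF g] by blast
        then show ?thesis
          using g tree_labeling_apply[of x A ?T k] F(3)
          by (simp add: t_def shift_by_def avoiding_iff)
      qed
      then show ?thesis
        unfolding labelings_def by (fastforce simp: ran_def dom_def t_def split: if_splits)
    qed
    moreover have "shift_by g t |` initial_part (follower_set ?T g) m \<notin> F" if g: "g \<in> ?T" for g m
    proof
      assume in_F: "shift_by g t |` initial_part (follower_set ?T g) m \<in> F"
      obtain k x where k: "k \<in> ?T" "x \<in> X" "follower_set ?T k = follower_set ?T g"
          "Orb g = shift_by k x"
        using proj[OF g] by blast
      \<comment> \<open>The level \<open>m\<close> may exceed \<open>n\<close>, but a pattern in
        \<open>F\<close> has no vertex beyond level \<open>N \<le> n\<close>, so agreement up to
        \<open>n\<close> covers all of it.\<close>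
      have "shift_by g t h = shift_by k x h" if h: "h \<in> initial_part (follower_set ?T g) m" for h
      proof -
        have "g @ h \<in> ?T"
          using h by (simp add: initial_part_def in_follower_set_iff)
        then have "h \<in> dom (shift_by g t |` initial_part (follower_set ?T g) m)"
          using h \<open>t \<in> labelings A ?T\<close> by (auto simp: labelings_def shift_by_def)
        then have "length h \<le> N"
          by (rule N[OF in_F])
        then show ?thesis
          using t[of h g] h by (simp add: initial_part_def n_def k(4))
      qed
      then have "shift_by g t |` initial_part (follower_set ?T g) m =
          shift_by k x |` initial_part (follower_set ?T k) m"
        by (simp add: restrict_map_eq_iff k(3))
      with in_F k(1,2) show False
        by (simp add: F(3) avoiding_iff)
    qed
    ultimately have "t \<in> X"
      by (simp add: F(3) avoiding_iff)
    moreover have "shadowed_by ?T \<epsilon> Orb t"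
      unfolding shadowed_by_def
    proof
      fix g
      assume "g \<in> ?T"
      then have "label_dist (follower_set ?T g) (shift_by g t) (Orb g) \<le> 1 / 2 ^ n"
        by (intro label_dist_le Nil_in_follower_set t)
      with n show "label_dist (follower_set ?T g) (shift_by g t) (Orb g) < \<epsilon>"
        by linarith
    qed
    ultimately show ?thesis
      by blast
  qed
  then show "\<exists>\<delta>>0. \<forall>Orb. projected_pseudo_orbit ?T X \<delta> Orb \<longrightarrow> (\<exists>t\<in>X. shadowed_by ?T \<epsilon> Orb t)"
    by (intro exI[of _ "1 / 2 ^ n"]) simp
qed

section \<open>Shadowing implies finite type\<close>

text \<open>Approximations of \<open>t\<close> chosen independently at the vertices are compatible
  because all of them copy \<open>t\<close>. A shadowing point then has the same root labels as they
  do, and these are the labels of \<open>t\<close>.\<close>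

lemma shadowing_imp_mem:
  assumes shadow: "\<And>Orb. projected_pseudo_orbit (markov_cayley_tree S M) X \<delta> Orb \<Longrightarrow>
      \<exists>t\<in>X. shadowed_by (markov_cayley_tree S M) 1 Orb t"
    and n: "1 / 2 ^ n < \<delta>"
    and X: "X \<subseteq> labelings A (markov_cayley_tree S M)"
    and t: "t \<in> labelings A (markov_cayley_tree S M)"
    and approx: "\<And>g. g \<in> markov_cayley_tree S M \<Longrightarrow>
      \<exists>s\<in>projection (markov_cayley_tree S M) X (follower_set (markov_cayley_tree S M) g).
        \<forall>h. g @ h \<in> markov_cayley_tree S M \<longrightarrow> length h \<le> Suc n \<longrightarrow> s h = t (g @ h)"
  shows "t \<in> X"
proof -
  let ?T = "markov_cayley_tree S M"
  obtain Orb where Orb: "\<And>g. g \<in> ?T \<Longrightarrow> Orb g \<in> projection ?T X (follower_set ?T g)"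
    and Orb_apply: "\<And>g h. g @ h \<in> ?T \<Longrightarrow> length h \<le> Suc n \<Longrightarrow> Orb g h = t (g @ h)"
    using approx tree_appendD(1) by metis
  have "projected_pseudo_orbit ?T X \<delta> Orb"
    unfolding projected_pseudo_orbit_def
  proof (intro conjI ballI allI impI)
    show "projected_orbit ?T X Orb"
      by (simp add: projected_orbit_iff Orb)
    fix g a
    assume "g @ [a] \<in> ?T"
    \<comment> \<open>For words \<open>h\<close> of length at most \<open>n\<close> both sides equal
      \<open>t (g @ [a] @ h)\<close>. The first reads \<open>Orb g\<close> at level
      \<open>n + 1\<close>, hence \<open>Suc n\<close> in the approximation.\<close>
    then have "label_dist (follower_set ?T (g @ [a])) (shift_by [a] (Orb g)) (Orb (g @ [a]))
        \<le> 1 / 2 ^ n"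
      by (intro label_dist_le Nil_in_follower_set)
        (simp_all add: in_follower_set_iff shift_by_def Orb_apply)
    with n show "label_dist (follower_set ?T (g @ [a])) (shift_by [a] (Orb g)) (Orb (g @ [a])) < \<delta>"
      by linarith
  qed
  then obtain x where x: "x \<in> X" "shadowed_by ?T 1 Orb x"
    using shadow by blast
  have "x g = t g" if "g \<in> ?T" for g
  proof -
    have "shift_by g x [] = Orb g []"
    proof (rule eq_on_if_label_dist_less[where n = 0])
      show "label_dist (follower_set ?T g) (shift_by g x) (Orb g) < 1 / 2 ^ 0"
        using x(2) that by (simp add: shadowed_by_def)
    qed (use that in \<open>simp_all add: Nil_in_follower_set\<close>)
    then show ?thesis
      using that by (simp add: shift_by_def Orb_apply)
  qed
  moreover have "x g = t g" if "g \<notin> ?T" for g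
  proof -
    have "dom x = ?T" "dom t = ?T"
      using X x(1) t by (auto simp: labelings_def)
    with that show ?thesis
      by (metis domIff)
  qed
  ultimately have "x = t"
    by (intro ext) blast
  with x(1) show ?thesis
    by simp
qed

lemma shadowing_imp_finite_type:
  assumes "finite S" and inf: "infinite (markov_cayley_tree S M)" and "finite A"
    and X: "X \<subseteq> labelings A (markov_cayley_tree S M)"
    and "shadowing_property (markov_cayley_tree S M) X"
  shows "tree_shift_of_finite_type (markov_cayley_tree S M) A X"
proof -
  let ?T = "markov_cayley_tree S M"
  obtain \<delta> :: real where \<delta>: "\<delta> > 0"
    and shadow: "\<And>Orb. projected_pseudo_orbit ?T X \<delta> Orb \<Longrightarrow> \<exists>t\<in>X. shadowed_by ?T 1 Orb t"
    using assms(5) unfolding shadowing_property_def by (meson zero_less_one)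
  obtain n :: nat where n: "1 / 2 ^ n < \<delta>"
    using exists_inverse_power_less[OF \<delta>] .
  \<comment> \<open>One level beyond \<open>n\<close> is lost in passing along an edge of the pseudo
    orbit, a second one in passing from a leaf to its parent.\<close>
  define N where "N = n + 2"
  \<comment> \<open>The type \<open>{[]}\<close> is left out: its patterns also arise as height 0
    restrictions at vertices of every type, so forbidding one could exclude points of
    \<open>X\<close>.\<close>
  define F where "F = (\<Union>\<eta>\<in>follower_sets ?T - {{[]}}.
    labelings A (initial_part \<eta> N) - (\<lambda>s. s |` initial_part \<eta> N) ` projection ?T X \<eta>)"
  have "F \<subseteq> tree_patterns ?T A"
    by (auto simp: F_def tree_patterns_def)
  moreover have "finite F"
    unfolding F_def using assms(1,3)
    by (intro finite_UN_I finite_Diff finite_labelings finite_initial_part finite_follower_sets) auto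
  moreover have "t \<in> avoiding ?T A F" if t: "t \<in> X" for t
    unfolding avoiding_iff
  proof (intro conjI ballI allI notI)
    fix g m
    let ?p = "shift_by g t |` initial_part (follower_set ?T g) m"
    assume g: "g \<in> ?T" and "?p \<in> F"
    then obtain \<eta> where \<eta>: "\<eta> \<in> follower_sets ?T" "\<eta> \<noteq> {[]}" "?p \<in> labelings A (initial_part \<eta> N)"
        "?p \<notin> (\<lambda>s. s |` initial_part \<eta> N) ` projection ?T X \<eta>"
      by (auto simp: F_def)
    have "shift_by g t \<in> labelings A (follower_set ?T g)"
      using shift_by_in_labelings X t by blast
    \<comment> \<open>A pattern in \<open>F\<close> does not record its type. Its domain recovers
      it, so a pattern forbidden for \<open>\<eta>\<close> can only appear at a vertex of type
      \<open>\<eta>\<close>.\<close>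
    then have "initial_part (follower_set ?T g) m = dom ?p"
      by (auto simp: labelings_def initial_part_def simp del: domIff)
    then have eq: "initial_part (follower_set ?T g) m = initial_part \<eta> N"
      using \<eta>(3) by (simp add: labelings_def)
    have "follower_set ?T g \<in> follower_sets ?T"
      using g by (simp add: follower_sets_def)
    then have "follower_set ?T g = \<eta>"
      using follower_sets_eq_if_initial_part_eq[OF \<eta>(1) _ \<eta>(2) _ eq] by (simp add: N_def)
    then have "shift_by g t \<in> projection ?T X \<eta>"
      using t g projection_iff by blast
    then show False
      using \<eta>(4) unfolding eq by blast
  qed (use t X in blast)
  moreover have "t \<in> X" if "t \<in> avoiding ?T A F" for t
  proof -
    have t: "t \<in> labelings A ?T"
      using that by (simp add: avoiding_iff)
    have approx: "\<exists>s\<in>projection ?T X (follower_set ?T g).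
        \<forall>h. g @ h \<in> ?T \<longrightarrow> length h \<le> N \<longrightarrow> s h = t (g @ h)"
      if g: "g \<in> ?T" "follower_set ?T g \<noteq> {[]}" for g
    proof -
      let ?\<eta> = "follower_set ?T g"
      have "shift_by g t \<in> labelings A ?\<eta>"
        using shift_by_in_labelings t by blast
      then have "shift_by g t |` initial_part ?\<eta> N \<in> labelings A (initial_part ?\<eta> N)"
        by (rule restrict_in_labelings) (auto simp: initial_part_def)
      moreover have "shift_by g t |` initial_part ?\<eta> N \<notin> F"
        using \<open>t \<in> avoiding ?T A F\<close> g(1) by (simp add: avoiding_iff)
      ultimately obtain s where "s \<in> projection ?T X ?\<eta>"
          "shift_by g t |` initial_part ?\<eta> N = s |` initial_part ?\<eta> N"
        using g by (auto simp: F_def follower_sets_def)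
      then show ?thesis
        by (auto simp: restrict_map_eq_iff initial_part_def in_follower_set_iff shift_by_def)
    qed
    have approx': "\<exists>s\<in>projection ?T X (follower_set ?T g).
        \<forall>h. g @ h \<in> ?T \<longrightarrow> length h \<le> Suc n \<longrightarrow> s h = t (g @ h)" if g: "g \<in> ?T" for g
    proof (cases "follower_set ?T g = {[]}")
      case False
      then show ?thesis
        using approx[OF g] by (force simp: N_def)
    next
      case True
      \<comment> \<open>The root has the infinite set \<open>?T\<close> as its type, so a leaf is
        not the root and has a parent \<open>k\<close>, which is not a leaf itself.\<close>
      have "follower_set ?T [] = ?T"
        by (simp add: follower_set_def)
      then have "g \<noteq> []"
        using True inf by (metis finite.emptyI finite.insertI)
      then obtain k a where ka: "g = k @ [a]"
        by (metis rev_exhaust)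
      with g have k: "k \<in> ?T"
        using tree_appendD(1) by blast
      have "[a] \<in> follower_set ?T k"
        using g ka by (simp add: in_follower_set_iff)
      then have "follower_set ?T k \<noteq> {[]}"
        by auto
      then obtain s where s: "s \<in> projection ?T X (follower_set ?T k)"
          "\<And>h. k @ h \<in> ?T \<Longrightarrow> length h \<le> N \<Longrightarrow> s h = t (k @ h)"
        using approx[OF k] by blast
      have "shift_by [a] s \<in> projection ?T X (follower_set ?T g)"
        using projection_child[OF s(1)] g by (simp add: ka)
      \<comment> \<open>A word \<open>h\<close> of length at most \<open>n + 1\<close> below the
        leaf is read in \<open>s\<close> as \<open>a # h\<close>, of length at most
        \<open>n + 2 = N\<close>.\<close>
      then show ?thesis
        by (rule bexI[rotated]) (simp add: ka shift_by_def s(2) N_def)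
    qed
    show ?thesis
      by (rule shadowing_imp_mem[OF _ n X t]) (fact shadow, fact approx')
  qed
  ultimately show ?thesis
    unfolding tree_shift_of_finite_type_def by blast
qed

theorem theorem1p12:
  fixes S :: "'g set" and M :: "'g \<Rightarrow> 'g \<Rightarrow> nat"
    and A :: "'a set" and X :: "('g list \<rightharpoonup> 'a) set"
  assumes "finite S"
    and "\<forall>i\<in>S. \<forall>j\<in>S. M i j \<in> {0, 1}"
    and "infinite (markov_cayley_tree S M)"
    and "finite A"
    and "tree_shift (markov_cayley_tree S M) A X"
  shows "tree_shift_of_finite_type (markov_cayley_tree S M) A X \<longleftrightarrow>
         shadowing_property (markov_cayley_tree S M) X"
proof
  have "X \<subseteq> labelings A (markov_cayley_tree S M)"
    using assms(5) by (auto simp: tree_shift_def avoiding_def)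
  then show "shadowing_property (markov_cayley_tree S M) X \<Longrightarrow>
      tree_shift_of_finite_type (markov_cayley_tree S M) A X"
    by (rule shadowing_imp_finite_type[OF assms(1,3,4)])
qed (rule finite_type_imp_shadowing)

end
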